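(* Assume the following conditions. 1. The functions $\alpha,\beta:\mathbb{Z}[n_0,n_{p+1}]\to\mathbb{R}$ are, respectively, a lower and an upper solution of the initial value problem (IVP) $$\begin{aligned} &x(n+1)=f(n,x(n),x(n+1)) && \text{for } n\in\bigcup_{k=0}^{p}I_k,\\ &x(n_k)=F(k,x(n_k-1)) && \text{for } k\in\mathbb{Z}[1,p],\\ &x(n)=g(n,x(n),x(n_k)) && \text{for } n\in J_k,\ k\in\mathbb{Z}[1,p],\\ &x(n_0)=x_0, \end{aligned}$$ and $\alpha(n)\le\beta(n)$ for all $n\in\mathbb{Z}[n_0,n_{p+1}]$. 2. For each $n\in\bigcup_{k=0}^{p}I_k$, the function $f(n,\cdot,\cdot)$ is continuous in its two real arguments on $[\alpha(n),\beta(n)]\times[\alpha(n+1),\beta(n+1)]$, and there exist functions $K:\bigcup_{k=0}^{p}I_k\to(-\infty,1)$ and $P:\bigcup_{k=0}^{p}I_k\to(0,\infty)$ such that for every $n\in\bigcup_{k=0}^{p}I_k$, all $x_1,x_2\in[\alpha(n),\beta(n)]$ with $x_1\le x_2$, and all $x_3,x_4\in[\alpha(n+1),\beta(n+1)]$ with $x_3\le x_4$, $$f(n,x_1,x_3)-f(n,x_2,x_4)\le P(n)(x_1-x_2)+K(n)(x_3-x_4).$$ 3. The function $F:\mathbb{Z}[1,p]\times\mathbb{R}\to\mathbb{R}$ is continuous in its second argument, and there exists a function $T:\mathbb{Z}[1,p]\to(0,\infty)$ such that for every $k\in\mathbb{Z}[1,p]$ and all $z_1,z_2\in[\alpha(n_k-1),\beta(n_k-1)]$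 with $z_1\le z_2$, $$F(k,z_1)-F(k,z_2)\le T(k)(z_1-z_2).$$ 4. For each $k\in\mathbb{Z}[1,p]$ and $n\in J_k$, the function $g(n,\cdot,\cdot)$ is continuous in its two real arguments on $[\alpha(n),\beta(n)]\times[\alpha(n_k),\beta(n_k)]$, and there exist functions $M:\bigcup_{k=1}^{p}J_k\to(-\infty,1)$ and $L:\bigcup_{k=1}^{p}J_k\to(0,\infty)$ such that for every $k\in\mathbb{Z}[1,p]$, every $n\in J_k$, all $y_1,y_2\in[\alpha(n),\beta(n)]$ with $y_1\le y_2$, and all $y_3,y_4\in[\alpha(n_k),\beta(n_k)]$ with $y_3\le y_4$, $$g(n,y_1,y_3)-g(n,y_2,y_4)\le M(n)(y_1-y_2)+L(n)(y_3-y_4).$$ Then there exist two sequences of functions $\{\alpha^{(j)}\}_{j=0}^{\infty}$ and $\{\beta^{(j)}\}_{j=0}^{\infty}$ from $\mathbb{Z}[n_0,n_{p+1}]$ to $\mathbb{R}$, with $\alpha^{(0)}=\alpha$ and $\beta^{(0)}=\beta$, such that: (a) the sequence $\{\alpha^{(j)}\}$ is nondecreasing in $j$, the sequence $\{\beta^{(j)}\}$ is nonincreasing in $j$ (pointwise), and $\alpha(n)\le\alpha^{(j)}(n)\le\beta^{(j)}(n)\le\beta(n)$ for all $n\in\mathbb{Z}[n_0,n_{p+1}]$ and all $j$; (b) for every $j$, $\alpha^{(j)}$ is a lower solution and $\beta^{(j)}$ is an upper solution of the IVP; (c) both sequences converge on $\mathbb{Z}[n_0,n_{p+1}]$; (d)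 the limits $A(n)=\lim_{j\to\infty}\alpha^{(j)}(n)$ and $B(n)=\lim_{j\to\infty}\beta^{(j)}(n)$ are, respectively, the minimal and the maximal solution of the IVP in $S(\alpha,\beta)$; (e) if the IVP has a unique solution $u\in S(\alpha,\beta)$, then $A(n)=u(n)=B(n)$ for all $n\in\mathbb{Z}[n_0,n_{p+1}]$.
   Context: $\mathbb{Z}_+$ denotes the set of nonnegative integers, and for $a,b\in\mathbb{Z}_+$ with $a<b$ (degenerate ranges are read in the same way), $\mathbb{Z}[a,b]=\{z\in\mathbb{Z}_+: a\le z\le b\}$. Fix a positive integer $p$, an increasing sequence $\{n_i\}_{i=0}^{p+1}$ in $\mathbb{Z}_+$ with $n_i\ge n_{i-1}+3$ for $i=1,\dots,p$, and integers $d_1,\dots,d_p\in\mathbb{Z}_+$ with $1\le d_i\le n_{i+1}-n_i-2$ for $i=1,\dots,p$; put $d_0=0$. Define $$I_k=\mathbb{Z}[n_k+d_k,\,n_{k+1}-2]\ (0\le k\le p-1),\quad I_p=\mathbb{Z}[n_p+d_p,\,n_{p+1}-1],\quad J_k=\mathbb{Z}[n_k+1,\,n_k+d_k]\ (1\le k\le p).$$ The data of the IVP are $x_0\in\mathbb{R}$ and functions $f:\bigcup_{k=0}^{p}I_k\times\mathbb{R}\times\mathbb{R}\to\mathbb{R}$, $F:\mathbb{Z}[1,p]\times\mathbb{R}\to\mathbb{R}$, $g:\bigcup_{k=1}^{p}J_k\times\mathbb{R}\times\mathbb{R}\to\mathbb{R}$. A solution of the IVP is a function $x:\mathbb{Z}[n_0,n_{p+1}]\to\mathbb{R}$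 satisfying all its equations. A function $\alpha:\mathbb{Z}[n_0,n_{p+1}]\to\mathbb{R}$ is a lower solution of the IVP if $\alpha(n+1)\le f(n,\alpha(n),\alpha(n+1))$ for $n\in\bigcup_{k=0}^{p}I_k$; $\alpha(n_k)\le F(k,\alpha(n_k-1))$ for $k\in\mathbb{Z}[1,p]$; $\alpha(n)\le g(n,\alpha(n),\alpha(n_k))$ for $n\in J_k$, $k\in\mathbb{Z}[1,p]$; and $\alpha(n_0)\le x_0$. It is an upper solution if all these inequalities hold with $\ge$ in place of $\le$. $S(\alpha,\beta)=\{u:\mathbb{Z}[n_0,n_{p+1}]\to\mathbb{R}:\ \alpha(n)\le u(n)\le\beta(n)\text{ for all } n\in\mathbb{Z}[n_0,n_{p+1}]\}$. A minimal (maximal) solution of the IVP in $S(\alpha,\beta)$ is a solution $v\in S(\alpha,\beta)$ of the IVP such that for every solution $u\in S(\alpha,\beta)$ of the IVP, $v(n)\le u(n)$ (respectively $v(n)\ge u(n)$) for all $n\in\mathbb{Z}[n_0,n_{p+1}]$. *)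

theory Defs
  imports Complex_Main
begin

text \<open>
  Functions on the grid \<open>{n 0..n (p+1)}\<close> are represented by total functions \<open>nat \<Rightarrow> real\<close>;
  only their values on the grid are ever constrained, and two of them count as equal
  if they agree on the grid.
\<close>

definition grid :: "nat \<Rightarrow> (nat \<Rightarrow> nat) \<Rightarrow> nat set" where
  "grid p n = {n 0..n (p + 1)}"

text \<open>
  The bound \<open>d i \<le> n (i+1) - n i - 2\<close> is written additively, avoiding truncated subtraction.
\<close>

definition impulse_data :: "nat \<Rightarrow> (nat \<Rightarrow> nat) \<Rightarrow> (nat \<Rightarrow> nat) \<Rightarrow> bool" where
  "impulse_data p n d \<longleftrightarrow>
     1 \<le> p \<and>
     strict_mono_on {0..p + 1} n \<and>
     (\<forall>i\<in>{1..p}. n (i - 1) + 3 \<le> n i) \<and>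
     d 0 = 0 \<and>
     (\<forall>i\<in>{1..p}. 1 \<le> d i \<and> n i + d i + 2 \<le> n (i + 1))"

text \<open>
  Under \<open>impulse_data p n d\<close> we have \<open>n (k+1) \<ge> 3\<close> for all \<open>k \<le> p\<close>,
  so the subtractions below do not truncate.
\<close>

definition I_set :: "nat \<Rightarrow> (nat \<Rightarrow> nat) \<Rightarrow> (nat \<Rightarrow> nat) \<Rightarrow> nat \<Rightarrow> nat set" where
  "I_set p n d k =
     (if k < p then {n k + d k..n (k + 1) - 2} else {n p + d p..n (p + 1) - 1})"

definition I_union :: "nat \<Rightarrow> (nat \<Rightarrow> nat) \<Rightarrow> (nat \<Rightarrow> nat) \<Rightarrow> nat set" where
  "I_union p n d = (\<Union>k\<in>{0..p}. I_set p n d k)"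

definition J_set :: "(nat \<Rightarrow> nat) \<Rightarrow> (nat \<Rightarrow> nat) \<Rightarrow> nat \<Rightarrow> nat set" where
  "J_set n d k = {n k + 1..n k + d k}"

definition J_union :: "nat \<Rightarrow> (nat \<Rightarrow> nat) \<Rightarrow> (nat \<Rightarrow> nat) \<Rightarrow> nat set" where
  "J_union p n d = (\<Union>k\<in>{1..p}. J_set n d k)"

text \<open>
  The relations of the initial value problem with \<open>R\<close> in place of equality; the instances
  \<open>(=)\<close>, \<open>(\<le>)\<close> and \<open>(\<ge>)\<close> are solutions, lower solutions and upper solutions.
\<close>

definition ivp_rel ::
  "(real \<Rightarrow> real \<Rightarrow> bool) \<Rightarrow> nat \<Rightarrow> (nat \<Rightarrow> nat) \<Rightarrow> (nat \<Rightarrow> nat) \<Rightarrow>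
   (nat \<Rightarrow> real \<Rightarrow> real \<Rightarrow> real) \<Rightarrow> (nat \<Rightarrow> real \<Rightarrow> real) \<Rightarrow> (nat \<Rightarrow> real \<Rightarrow> real \<Rightarrow> real) \<Rightarrow>
   real \<Rightarrow> (nat \<Rightarrow> real) \<Rightarrow> bool" where
  "ivp_rel R p n d f F g x0 x \<longleftrightarrow>
     (\<forall>m\<in>I_union p n d. R (x (m + 1)) (f m (x m) (x (m + 1)))) \<and>
     (\<forall>k\<in>{1..p}. R (x (n k)) (F k (x (n k - 1)))) \<and>
     (\<forall>k\<in>{1..p}. \<forall>m\<in>J_set n d k. R (x m) (g m (x m) (x (n k)))) \<and>
     R (x (n 0)) x0"

definition ivp_solution ::
  "nat \<Rightarrow> (nat \<Rightarrow> nat) \<Rightarrow> (nat \<Rightarrow> nat) \<Rightarrow>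
   (nat \<Rightarrow> real \<Rightarrow> real \<Rightarrow> real) \<Rightarrow> (nat \<Rightarrow> real \<Rightarrow> real) \<Rightarrow> (nat \<Rightarrow> real \<Rightarrow> real \<Rightarrow> real) \<Rightarrow>
   real \<Rightarrow> (nat \<Rightarrow> real) \<Rightarrow> bool" where
  "ivp_solution = ivp_rel (=)"

definition lower_solution ::
  "nat \<Rightarrow> (nat \<Rightarrow> nat) \<Rightarrow> (nat \<Rightarrow> nat) \<Rightarrow>
   (nat \<Rightarrow> real \<Rightarrow> real \<Rightarrow> real) \<Rightarrow> (nat \<Rightarrow> real \<Rightarrow> real) \<Rightarrow> (nat \<Rightarrow> real \<Rightarrow> real \<Rightarrow> real) \<Rightarrow>
   real \<Rightarrow> (nat \<Rightarrow> real) \<Rightarrow> bool" where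
  "lower_solution = ivp_rel (\<le>)"

definition upper_solution ::
  "nat \<Rightarrow> (nat \<Rightarrow> nat) \<Rightarrow> (nat \<Rightarrow> nat) \<Rightarrow>
   (nat \<Rightarrow> real \<Rightarrow> real \<Rightarrow> real) \<Rightarrow> (nat \<Rightarrow> real \<Rightarrow> real) \<Rightarrow> (nat \<Rightarrow> real \<Rightarrow> real \<Rightarrow> real) \<Rightarrow>
   real \<Rightarrow> (nat \<Rightarrow> real) \<Rightarrow> bool" where
  "upper_solution = ivp_rel (\<ge>)"

definition sector ::
  "nat \<Rightarrow> (nat \<Rightarrow> nat) \<Rightarrow> (nat \<Rightarrow> real) \<Rightarrow> (nat \<Rightarrow> real) \<Rightarrow> (nat \<Rightarrow> real) set" where
  "sector p n \<alpha> \<beta> = {u. \<forall>m\<in>grid p n. \<alpha> m \<le> u m \<and> u m \<le> \<beta> m}"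

definition solutions_in ::
  "nat \<Rightarrow> (nat \<Rightarrow> nat) \<Rightarrow> (nat \<Rightarrow> nat) \<Rightarrow>
   (nat \<Rightarrow> real \<Rightarrow> real \<Rightarrow> real) \<Rightarrow> (nat \<Rightarrow> real \<Rightarrow> real) \<Rightarrow> (nat \<Rightarrow> real \<Rightarrow> real \<Rightarrow> real) \<Rightarrow>
   real \<Rightarrow> (nat \<Rightarrow> real) set \<Rightarrow> (nat \<Rightarrow> real) set" where
  "solutions_in p n d f F g x0 S = {u \<in> S. ivp_solution p n d f F g x0 u}"

definition minimal_solution ::
  "nat \<Rightarrow> (nat \<Rightarrow> nat) \<Rightarrow> (nat \<Rightarrow> nat) \<Rightarrow>
   (nat \<Rightarrow> real \<Rightarrow> real \<Rightarrow> real) \<Rightarrow> (nat \<Rightarrow> real \<Rightarrow> real) \<Rightarrow> (nat \<Rightarrow> real \<Rightarrow> real \<Rightarrow> real) \<Rightarrow>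
   real \<Rightarrow> (nat \<Rightarrow> real) set \<Rightarrow> (nat \<Rightarrow> real) \<Rightarrow> bool" where
  "minimal_solution p n d f F g x0 S v \<longleftrightarrow>
     v \<in> solutions_in p n d f F g x0 S \<and>
     (\<forall>u\<in>solutions_in p n d f F g x0 S. \<forall>m\<in>grid p n. v m \<le> u m)"

definition maximal_solution ::
  "nat \<Rightarrow> (nat \<Rightarrow> nat) \<Rightarrow> (nat \<Rightarrow> nat) \<Rightarrow>
   (nat \<Rightarrow> real \<Rightarrow> real \<Rightarrow> real) \<Rightarrow> (nat \<Rightarrow> real \<Rightarrow> real) \<Rightarrow> (nat \<Rightarrow> real \<Rightarrow> real \<Rightarrow> real) \<Rightarrow>
   real \<Rightarrow> (nat \<Rightarrow> real) set \<Rightarrow> (nat \<Rightarrow> real) \<Rightarrow> bool" where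
  "maximal_solution p n d f F g x0 S v \<longleftrightarrow>
     v \<in> solutions_in p n d f F g x0 S \<and>
     (\<forall>u\<in>solutions_in p n d f F g x0 S. \<forall>m\<in>grid p n. v m \<ge> u m)"

text \<open>Uniqueness is uniqueness as a function on the grid.\<close>

definition unique_solution ::
  "nat \<Rightarrow> (nat \<Rightarrow> nat) \<Rightarrow> (nat \<Rightarrow> nat) \<Rightarrow>
   (nat \<Rightarrow> real \<Rightarrow> real \<Rightarrow> real) \<Rightarrow> (nat \<Rightarrow> real \<Rightarrow> real) \<Rightarrow> (nat \<Rightarrow> real \<Rightarrow> real \<Rightarrow> real) \<Rightarrow>
   real \<Rightarrow> (nat \<Rightarrow> real) set \<Rightarrow> (nat \<Rightarrow> real) \<Rightarrow> bool" where
  "unique_solution p n d f F g x0 S u \<longleftrightarrow>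
     u \<in> solutions_in p n d f F g x0 S \<and>
     (\<forall>v\<in>solutions_in p n d f F g x0 S. \<forall>m\<in>grid p n. v m = u m)"

end

theory Submission
  imports Defs
begin

text \<open>
  Every node of the grid carries exactly one condition of the problem, and that condition ties
  the value \<open>y\<close> at the node to the value \<open>s\<close> at one other node, its predecessor
  (the start node serves as its own). The problem is thus a system \<open>x m = h m (x (\<pi> m)) (x m)\<close>,
  and lower and upper solutions satisfy the same system with an inequality sign. Impulse, delay
  and step nodes differ only in the formula for \<open>h\<close>, and the one-sided Lipschitz
  bounds make \<open>h m s y - K m * y\<close> nondecreasing in \<open>s\<close> and in \<open>y\<close>, with \<open>K m < 1\<close>.

  Subtracting \<open>K m * x m\<close> on both sides and dividing by \<open>1 - K m > 0\<close> turns the system into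
  \<open>x = T x\<close> with
  \<open>T u m = (h m (u (\<pi> m)) (u m) - K m * u m) / (1 - K m)\<close>, which is monotone and continuous between
  \<open>\<alpha>\<close> and \<open>\<beta>\<close>. Because the division preserves order, \<open>u\<close> is a lower solution iff \<open>u \<le> T u\<close>, an upper
  solution iff \<open>T u \<le> u\<close> and a solution iff \<open>T u = u\<close>. The sequences are the iterates of
  \<open>T\<close> from \<open>\<alpha>\<close> and from \<open>\<beta>\<close>: monotonicity makes them monotone
  in the index and keeps the lower ones below the upper ones and below every solution in between,
  boundedness makes them converge, and continuity makes the limits fixed points. A limit of lower
  iterates that is itself a solution and lies below all solutions is the minimal one; dually for
  the maximal one.
\<close>

section \<open>Iterating a monotone operator between ordered functions\<close>

definition order_interval :: "'a set \<Rightarrow> ('a \<Rightarrow> real) \<Rightarrow> ('a \<Rightarrow> real) \<Rightarrow> ('a \<Rightarrow> real) set" where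
  "order_interval G \<alpha> \<beta> = {u. \<forall>m\<in>G. \<alpha> m \<le> u m \<and> u m \<le> \<beta> m}"

locale monotone_iteration =
  fixes G :: "'a set" and \<alpha> \<beta> :: "'a \<Rightarrow> real" and T :: "('a \<Rightarrow> real) \<Rightarrow> 'a \<Rightarrow> real"
  assumes ordered: "m \<in> G \<Longrightarrow> \<alpha> m \<le> \<beta> m"
    and start_below: "m \<in> G \<Longrightarrow> \<alpha> m \<le> T \<alpha> m"
    and start_above: "m \<in> G \<Longrightarrow> T \<beta> m \<le> \<beta> m"
    and mono: "\<lbrakk>u \<in> order_interval G \<alpha> \<beta>; v \<in> order_interval G \<alpha> \<beta>; \<And>i. i \<in> G \<Longrightarrow> u i \<le> v i; m \<in> G\<rbrakk>
      \<Longrightarrow> T u m \<le> T v m"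
    and cont: "\<lbrakk>\<And>j. X j \<in> order_interval G \<alpha> \<beta>; u \<in> order_interval G \<alpha> \<beta>;
      \<And>i. i \<in> G \<Longrightarrow> (\<lambda>j. X j i) \<longlonglongrightarrow> u i; m \<in> G\<rbrakk> \<Longrightarrow> (\<lambda>j. T (X j) m) \<longlonglongrightarrow> T u m"
begin

lemma endpoints_in: "\<alpha> \<in> order_interval G \<alpha> \<beta>" "\<beta> \<in> order_interval G \<alpha> \<beta>"
  using ordered by (auto simp: order_interval_def)

lemma T_maps_interval:
  assumes "u \<in> order_interval G \<alpha> \<beta>"
  shows "T u \<in> order_interval G \<alpha> \<beta>"
proof -
  have "\<alpha> m \<le> T u m \<and> T u m \<le> \<beta> m" if m: "m \<in> G" for m
  proof -
    have "T \<alpha> m \<le> T u m" "T u m \<le> T \<beta> m"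
      using assms m by (auto intro!: mono simp: endpoints_in) (auto simp: order_interval_def)
    with start_below[OF m] start_above[OF m] show ?thesis by linarith
  qed
  then show ?thesis by (simp add: order_interval_def)
qed

abbreviation lo :: "nat \<Rightarrow> 'a \<Rightarrow> real" where "lo j \<equiv> (T ^^ j) \<alpha>"
abbreviation hi :: "nat \<Rightarrow> 'a \<Rightarrow> real" where "hi j \<equiv> (T ^^ j) \<beta>"

lemma iterates_in: "lo j \<in> order_interval G \<alpha> \<beta>" "hi j \<in> order_interval G \<alpha> \<beta>"
  by (induction j) (auto simp: endpoints_in T_maps_interval)

lemma lo_step: "m \<in> G \<Longrightarrow> lo j m \<le> T (lo j) m"
proof (induction j arbitrary: m)
  case (Suc j)
  have "T (lo j) m \<le> T (T (lo j)) m"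
    by (rule mono) (auto simp: Suc iterates_in T_maps_interval)
  then show ?case by simp
qed (simp add: start_below)

lemma hi_step: "m \<in> G \<Longrightarrow> T (hi j) m \<le> hi j m"
proof (induction j arbitrary: m)
  case (Suc j)
  have "T (T (hi j)) m \<le> T (hi j) m"
    by (rule mono) (auto simp: Suc iterates_in T_maps_interval)
  then show ?case by simp
qed (simp add: start_above)

lemma incseq_lo: "m \<in> G \<Longrightarrow> incseq (\<lambda>j. lo j m)"
  by (rule incseq_SucI) (simp add: lo_step)

lemma decseq_hi: "m \<in> G \<Longrightarrow> decseq (\<lambda>j. hi j m)"
  by (rule decseq_SucI) (simp add: hi_step)

lemma lo_le_hi: "m \<in> G \<Longrightarrow> lo j m \<le> hi j m"
proof (induction j arbitrary: m)
  case (Suc j)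
  have "T (lo j) m \<le> T (hi j) m"
    by (rule mono) (auto simp: Suc iterates_in)
  then show ?case by simp
qed (simp add: ordered)

lemma fixed_point_between:
  assumes u: "u \<in> order_interval G \<alpha> \<beta>" and fixed: "\<And>m. m \<in> G \<Longrightarrow> T u m = u m"
  shows "m \<in> G \<Longrightarrow> lo j m \<le> u m \<and> u m \<le> hi j m"
proof (induction j arbitrary: m)
  case 0
  then show ?case using u by (simp add: order_interval_def)
next
  case (Suc j)
  have "T (lo j) m \<le> T u m" "T u m \<le> T (hi j) m"
    by (rule mono; auto simp: Suc iterates_in u)+
  then show ?case using fixed Suc.prems by simp
qed

lemma lo_tendsto:
  assumes "m \<in> G"
  shows "(\<lambda>j. lo j m) \<longlonglongrightarrow> lim (\<lambda>j. lo j m)"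
proof -
  have "lo j m \<le> \<beta> m" for j
    using iterates_in(1)[of j] assms by (simp add: order_interval_def)
  then obtain L where "(\<lambda>j. lo j m) \<longlonglongrightarrow> L"
    using incseq_convergent[OF incseq_lo[OF assms]] by blast
  then show ?thesis by (simp add: limI)
qed

lemma hi_tendsto:
  assumes "m \<in> G"
  shows "(\<lambda>j. hi j m) \<longlonglongrightarrow> lim (\<lambda>j. hi j m)"
proof -
  have "\<alpha> m \<le> hi j m" for j
    using iterates_in(2)[of j] assms by (simp add: order_interval_def)
  then obtain L where "(\<lambda>j. hi j m) \<longlonglongrightarrow> L"
    using decseq_convergent[OF decseq_hi[OF assms]] by blast
  then show ?thesis by (simp add: limI)
qed

text \<open>
  The orbit shifted by one step converges both to the limit \<open>l\<close> of the orbit and, by continuity,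
  to \<open>T l\<close>.
\<close>

lemma orbit_limit_fixed:
  assumes orbit: "\<And>j. (T ^^ j) w \<in> order_interval G \<alpha> \<beta>"
    and lim: "\<And>i. i \<in> G \<Longrightarrow> (\<lambda>j. (T ^^ j) w i) \<longlonglongrightarrow> l i"
  shows "l \<in> order_interval G \<alpha> \<beta>" and "m \<in> G \<Longrightarrow> T l m = l m"
proof -
  show l: "l \<in> order_interval G \<alpha> \<beta>"
    using orbit unfolding order_interval_def
    by (auto intro: LIMSEQ_le_const[OF lim] LIMSEQ_le_const2[OF lim])
  assume m: "m \<in> G"
  have "(\<lambda>j. T ((T ^^ j) w) m) \<longlonglongrightarrow> T l m"
    by (rule cont[OF orbit l lim m])
  moreover have "(\<lambda>j. T ((T ^^ j) w) m) \<longlonglongrightarrow> l m"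
    using LIMSEQ_Suc[OF lim[OF m]] by simp
  ultimately show "T l m = l m" by (rule LIMSEQ_unique)
qed

end

section \<open>Systems with a one-sided slope bound\<close>

text \<open>
  Subtracting \<open>K m * y\<close> from both sides of an implicit equation \<open>y = h m s y\<close> makes its right-hand
  side monotone without changing the sense of the inequalities.
\<close>

locale slope_system =
  fixes G :: "'a set" and \<pi> :: "'a \<Rightarrow> 'a" and h :: "'a \<Rightarrow> real \<Rightarrow> real \<Rightarrow> real"
    and K :: "'a \<Rightarrow> real" and \<alpha> \<beta> :: "'a \<Rightarrow> real"
  assumes pred_in: "m \<in> G \<Longrightarrow> \<pi> m \<in> G"
    and slope_less: "m \<in> G \<Longrightarrow> K m < 1"
    and slope_bound: "\<lbrakk>m \<in> G; s1 \<in> {\<alpha> (\<pi> m)..\<beta> (\<pi> m)}; s2 \<in> {\<alpha> (\<pi> m)..\<beta> (\<pi> m)};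
      y1 \<in> {\<alpha> m..\<beta> m}; y2 \<in> {\<alpha> m..\<beta> m}; s1 \<le> s2; y1 \<le> y2\<rbrakk>
      \<Longrightarrow> h m s1 y1 - h m s2 y2 \<le> K m * (y1 - y2)"
    and continuous: "m \<in> G \<Longrightarrow>
      continuous_on ({\<alpha> (\<pi> m)..\<beta> (\<pi> m)} \<times> {\<alpha> m..\<beta> m}) (\<lambda>(s, y). h m s y)"
    and below: "m \<in> G \<Longrightarrow> \<alpha> m \<le> h m (\<alpha> (\<pi> m)) (\<alpha> m)"
    and above: "m \<in> G \<Longrightarrow> h m (\<beta> (\<pi> m)) (\<beta> m) \<le> \<beta> m"
    and ordered_ends: "m \<in> G \<Longrightarrow> \<alpha> m \<le> \<beta> m"
begin

definition relaxed :: "('a \<Rightarrow> real) \<Rightarrow> 'a \<Rightarrow> real" where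
  "relaxed u m = (h m (u (\<pi> m)) (u m) - K m * u m) / (1 - K m)"

lemma le_relaxed_iff: "m \<in> G \<Longrightarrow> u m \<le> relaxed u m \<longleftrightarrow> u m \<le> h m (u (\<pi> m)) (u m)"
  using slope_less[of m] by (simp add: relaxed_def pos_le_divide_eq algebra_simps)

lemma relaxed_le_iff: "m \<in> G \<Longrightarrow> relaxed u m \<le> u m \<longleftrightarrow> h m (u (\<pi> m)) (u m) \<le> u m"
  using slope_less[of m] by (simp add: relaxed_def pos_divide_le_eq algebra_simps)

lemma relaxed_eq_iff: "m \<in> G \<Longrightarrow> relaxed u m = u m \<longleftrightarrow> u m = h m (u (\<pi> m)) (u m)"
  using le_relaxed_iff[of m u] relaxed_le_iff[of m u] by linarith

lemma relaxed_mono: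
  assumes u: "u \<in> order_interval G \<alpha> \<beta>" and v: "v \<in> order_interval G \<alpha> \<beta>"
    and le: "\<And>i. i \<in> G \<Longrightarrow> u i \<le> v i" and m: "m \<in> G"
  shows "relaxed u m \<le> relaxed v m"
proof -
  have "h m (u (\<pi> m)) (u m) - h m (v (\<pi> m)) (v m) \<le> K m * (u m - v m)"
    using u v le m pred_in[OF m] by (intro slope_bound) (auto simp: order_interval_def)
  then show ?thesis
    using slope_less[OF m] unfolding relaxed_def
    by (intro divide_right_mono) (auto simp: algebra_simps)
qed

lemma relaxed_tendsto:
  assumes X: "\<And>j. X j \<in> order_interval G \<alpha> \<beta>" and u: "u \<in> order_interval G \<alpha> \<beta>"
    and lim: "\<And>i. i \<in> G \<Longrightarrow> (\<lambda>j. X j i) \<longlonglongrightarrow> u i" and m: "m \<in> G"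
  shows "(\<lambda>j. relaxed (X j) m) \<longlonglongrightarrow> relaxed u m"
proof -
  have "(\<lambda>j. case (X j (\<pi> m), X j m) of (s, y) \<Rightarrow> h m s y)
      \<longlonglongrightarrow> (case (u (\<pi> m), u m) of (s, y) \<Rightarrow> h m s y)"
    using X u lim m pred_in[OF m]
    by (intro continuous_on_tendsto_compose[OF continuous[OF m]] tendsto_Pair)
      (auto simp: order_interval_def)
  then have "(\<lambda>j. h m (X j (\<pi> m)) (X j m)) \<longlonglongrightarrow> h m (u (\<pi> m)) (u m)"
    by simp
  then show ?thesis
    unfolding relaxed_def using lim[OF m] slope_less[OF m] by (intro tendsto_intros) auto
qed

sublocale monotone_iteration G \<alpha> \<beta> relaxed
  using relaxed_mono relaxed_tendsto
  by unfold_locales (simp_all add: ordered_ends le_relaxed_iff relaxed_le_iff below above)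

end

section \<open>The condition attached to a node of the grid\<close>

text \<open>
  The last block is closed on the right: the end point \<open>n (p + 1)\<close> is reached by an ordinary step
  from \<open>I_set p n d p\<close>.
\<close>

definition block :: "nat \<Rightarrow> (nat \<Rightarrow> nat) \<Rightarrow> nat \<Rightarrow> nat set" where
  "block p n k = {m. n k \<le> m \<and> m \<le> n (p + 1) \<and> (k < p \<longrightarrow> m < n (k + 1))}"

definition block_index :: "nat \<Rightarrow> (nat \<Rightarrow> nat) \<Rightarrow> nat \<Rightarrow> nat" where
  "block_index p n m = Max {k. k \<le> p \<and> n k \<le> m}"

text \<open>
  A case distinction on nodes with the four alternatives start, impulse, delay and step. It is
  polymorphic in the result because predecessor, right-hand side and slope are all selected by it.
  The step alternative receives the node from which the step departs.
\<close>

definition by_node ::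
  "nat \<Rightarrow> (nat \<Rightarrow> nat) \<Rightarrow> (nat \<Rightarrow> nat) \<Rightarrow>
   'a \<Rightarrow> (nat \<Rightarrow> 'a) \<Rightarrow> (nat \<Rightarrow> nat \<Rightarrow> 'a) \<Rightarrow> (nat \<Rightarrow> 'a) \<Rightarrow> nat \<Rightarrow> 'a" where
  "by_node p n d start impulse delay step m =
     (let k = block_index p n m in
      if m = n k then (if k = 0 then start else impulse k)
      else if m \<le> n k + d k then delay k m
      else step (m - 1))"

context
  fixes p :: nat and n d :: "nat \<Rightarrow> nat"
  assumes data: "impulse_data p n d"
begin

lemma nodes_mono: "\<lbrakk>i \<le> j; j \<le> p + 1\<rbrakk> \<Longrightarrow> n i \<le> n j"
  using data strict_mono_on_leD[of "{0..p + 1}" n i j] by (simp add: impulse_data_def)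

lemma impulse_gap: "\<lbrakk>1 \<le> k; k \<le> p\<rbrakk> \<Longrightarrow> n (k - 1) + 3 \<le> n k"
  using data by (simp add: impulse_data_def)

lemma delay_zero: "d 0 = 0"
  using data by (simp add: impulse_data_def)

text \<open>For \<open>k = 0\<close> there is no delay and the gap before the first impulse supplies the room.\<close>

lemma delay_room: "k \<le> p \<Longrightarrow> n k + d k + 2 \<le> n (k + 1)"
  using data impulse_gap[of 1] by (cases "k = 0") (auto simp: impulse_data_def)

lemma block_index_eq:
  assumes "k \<le> p" and "m \<in> block p n k"
  shows "block_index p n m = k"
  unfolding block_index_def
proof (rule Max_eqI)
  fix k' assume k': "k' \<in> {k. k \<le> p \<and> n k \<le> m}"
  show "k' \<le> k"
  proof (rule ccontr)
    assume "\<not> k' \<le> k"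
    then have "n (k + 1) \<le> n k'" and "k < p"
      using k' by (auto intro: nodes_mono)
    then show False using k' assms by (auto simp: block_def)
  qed
qed (use assms in \<open>auto simp: block_def\<close>)

lemma grid_block:
  assumes "m \<in> grid p n"
  obtains k where "k \<le> p" "m \<in> block p n k"
proof -
  \<comment> \<open>The operator contains \<open>n k - 1\<close> through \<open>?\<pi>\<close>; unfolding 1 would hide it from its rules.\<close>
  note One_nat_def [simp del]
  let ?A = "{k. k \<le> p \<and> n k \<le> m}"
  have fin: "finite ?A" and "?A \<noteq> {}"
    using assms by (auto simp: grid_def)
  then have "Max ?A \<in> ?A" by (rule Max_in)
  moreover have "m < n (Max ?A + 1)" if "Max ?A < p"
  proof (rule ccontr)
    assume "\<not> ?thesis"
    then have "Max ?A + 1 \<in> ?A" using that by simp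
    then have "Max ?A + 1 \<le> Max ?A" using fin by (rule Max_ge[rotated])
    then show False by simp
  qed
  ultimately show thesis
    using assms by (intro that[of "Max ?A"]) (auto simp: block_def grid_def)
qed

lemma start_node:
  "n 0 \<in> grid p n" "by_node p n d s a b c (n 0) = s"
proof -
  have "n 0 \<in> block p n 0"
    using nodes_mono[of 0 "p + 1"] delay_room[of 0] by (simp add: block_def)
  then show "by_node p n d s a b c (n 0) = s"
    using block_index_eq[of 0 "n 0"] by (simp add: by_node_def Let_def)
  show "n 0 \<in> grid p n" using nodes_mono[of 0 "p + 1"] by (simp add: grid_def)
qed

lemma impulse_node:
  assumes "k \<in> {1..p}"
  shows "n k \<in> grid p n" "n k - 1 \<in> grid p n" "by_node p n d s a b c (n k) = a k"
proof -
  have bounds: "n k + d k + 2 \<le> n (k + 1)" "n (k + 1) \<le> n (p + 1)" "n k \<le> n (p + 1)"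
      "n 0 \<le> n (k - 1)" "n (k - 1) + 3 \<le> n k"
    using assms delay_room[of k] impulse_gap[of k] by (auto intro: nodes_mono)
  then have "n k \<in> block p n k" by (simp add: block_def)
  then show "by_node p n d s a b c (n k) = a k"
    using assms block_index_eq[of k "n k"] by (simp add: by_node_def Let_def)
  show "n k \<in> grid p n" "n k - 1 \<in> grid p n"
    using bounds by (auto simp: grid_def)
qed

lemma delay_node:
  assumes "k \<in> {1..p}" and m: "m \<in> J_set n d k"
  shows "m \<in> grid p n" "by_node p n d s a b c m = b k m"
proof -
  have bounds: "n k + d k + 2 \<le> n (k + 1)" "n (k + 1) \<le> n (p + 1)" "n 0 \<le> n k"
    using assms delay_room[of k] by (auto intro: nodes_mono)
  have J: "n k < m" "m \<le> n k + d k"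
    using m by (auto simp: J_set_def)
  with bounds have "m \<in> block p n k" by (simp add: block_def)
  then show "by_node p n d s a b c m = b k m"
    using assms J block_index_eq[of k m] by (simp add: by_node_def Let_def)
  show "m \<in> grid p n" using bounds J by (simp add: grid_def)
qed

lemma step_node:
  assumes "m \<in> I_union p n d"
  shows "m \<in> grid p n" "m + 1 \<in> grid p n" "by_node p n d s a b c (m + 1) = c m"
proof -
  obtain k where k: "k \<le> p" "m \<in> I_set p n d k"
    using assms by (auto simp: I_union_def)
  have bounds: "n k + d k + 2 \<le> n (k + 1)" "n (k + 1) \<le> n (p + 1)" "n 0 \<le> n k"
    using k delay_room[of k] by (auto intro: nodes_mono)
  have I: "n k + d k \<le> m" "m + 1 \<le> n (p + 1)" "k < p \<longrightarrow> m + 1 < n (k + 1)"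
    using k bounds by (auto simp: I_set_def split: if_splits)
  with bounds have "m + 1 \<in> block p n k" by (simp add: block_def)
  then show "by_node p n d s a b c (m + 1) = c m"
    using k I block_index_eq[of k "m + 1"] by (simp add: by_node_def Let_def)
  show "m \<in> grid p n" "m + 1 \<in> grid p n"
    using bounds I by (auto simp: grid_def)
qed

lemma node_cases:
  assumes "m \<in> grid p n"
  obtains (start) "m = n 0"
  | (impulse) k where "k \<in> {1..p}" "m = n k"
  | (delay) k where "k \<in> {1..p}" "m \<in> J_set n d k"
  | (step) m' where "m' \<in> I_union p n d" "m = m' + 1"
proof -
  obtain k where k: "k \<le> p" "m \<in> block p n k"
    using grid_block[OF assms] .
  consider "m = n k" | "n k < m" "m \<le> n k + d k" | "n k + d k < m"
    using k by (force simp: block_def)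
  then show thesis
  proof cases
    case 1
    then show thesis using k that(1) that(2)[of k] by (cases "k = 0") auto
  next
    case 2
    then have "k \<noteq> 0" using delay_zero by (intro notI) simp
    then show thesis using 2 k that(3)[of k] by (auto simp: J_set_def)
  next
    case 3
    then have "m - 1 \<in> I_set p n d k"
      using k by (auto simp: I_set_def block_def)
    then have "m - 1 \<in> I_union p n d" using k by (auto simp: I_union_def)
    then show thesis using 3 that(4)[of "m - 1"] by simp
  qed
qed

abbreviation predecessor :: "nat \<Rightarrow> nat" where
  "predecessor \<equiv> by_node p n d (n 0) (\<lambda>k. n k - 1) (\<lambda>k m. n k) (\<lambda>m. m)"

abbreviation right_hand_side ::
  "(nat \<Rightarrow> real \<Rightarrow> real \<Rightarrow> real) \<Rightarrow> (nat \<Rightarrow> real \<Rightarrow> real) \<Rightarrow> (nat \<Rightarrow> real \<Rightarrow> real \<Rightarrow> real) \<Rightarrow>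
   real \<Rightarrow> nat \<Rightarrow> real \<Rightarrow> real \<Rightarrow> real" where
  "right_hand_side f F g x0 \<equiv>
     by_node p n d (\<lambda>s y. x0) (\<lambda>k s y. F k s) (\<lambda>k m s y. g m y s) f"

lemma predecessor_in_grid: "m \<in> grid p n \<Longrightarrow> predecessor m \<in> grid p n"
  by (cases m rule: node_cases)
    (simp_all add: start_node impulse_node delay_node step_node del: One_nat_def Suc_eq_plus1)

text \<open>
  The three families of conditions and the initial condition index disjoint sets of nodes that
  exhaust the grid, so they merge into one condition per node.
\<close>

lemma ivp_rel_iff_nodewise:
  "ivp_rel R p n d f F g x0 x \<longleftrightarrow>
     (\<forall>m\<in>grid p n. R (x m) (right_hand_side f F g x0 m (x (predecessor m)) (x m)))"
  (is "?ivp \<longleftrightarrow> ?nodewise")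
proof
  assume ivp: ?ivp
  show ?nodewise
  proof
    fix m assume "m \<in> grid p n"
    then show "R (x m) (right_hand_side f F g x0 m (x (predecessor m)) (x m))"
    proof (cases rule: node_cases)
      case start
      then show ?thesis using ivp by (simp only: start_node ivp_rel_def)
    next
      case (impulse k)
      then show ?thesis using ivp by (simp only: impulse_node ivp_rel_def)
    next
      case (delay k)
      then show ?thesis using ivp by (simp only: delay_node ivp_rel_def)
    next
      case (step m')
      then show ?thesis using ivp by (simp only: step_node ivp_rel_def)
    qed
  qed
next
  assume nodewise: ?nodewise
  show ?ivp
    unfolding ivp_rel_def
  proof (intro conjI ballI)
    fix m assume "m \<in> I_union p n d"
    then show "R (x (m + 1)) (f m (x m) (x (m + 1)))"
      using nodewise[rule_format, of "m + 1"] by (simp only: step_node)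
  next
    fix k assume "k \<in> {1..p}"
    then show "R (x (n k)) (F k (x (n k - 1)))"
      using nodewise[rule_format, of "n k"] by (simp only: impulse_node)
  next
    fix k m assume "k \<in> {1..p}" "m \<in> J_set n d k"
    then show "R (x m) (g m (x m) (x (n k)))"
      using nodewise[rule_format, of m] by (simp only: delay_node)
  next
    show "R (x (n 0)) x0"
      using nodewise[rule_format, of "n 0"] by (simp only: start_node)
  qed
qed

end

section \<open>Extremal solutions by monotone iteration\<close>

theorem theorem1:
  fixes p :: nat and n d :: "nat \<Rightarrow> nat"
    and f :: "nat \<Rightarrow> real \<Rightarrow> real \<Rightarrow> real"
    and F :: "nat \<Rightarrow> real \<Rightarrow> real"
    and g :: "nat \<Rightarrow> real \<Rightarrow> real \<Rightarrow> real"
    and x0 :: real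
    and \<alpha> \<beta> :: "nat \<Rightarrow> real"
  assumes data: "impulse_data p n d"
    and lower: "lower_solution p n d f F g x0 \<alpha>"
    and upper: "upper_solution p n d f F g x0 \<beta>"
    and ordered: "\<forall>m\<in>grid p n. \<alpha> m \<le> \<beta> m"
    and f_cont: "\<forall>m\<in>I_union p n d.
      continuous_on ({\<alpha> m..\<beta> m} \<times> {\<alpha> (m + 1)..\<beta> (m + 1)}) (\<lambda>(x, y). f m x y)"
    and f_bound: "\<exists>K P :: nat \<Rightarrow> real. \<forall>m\<in>I_union p n d. K m < 1 \<and> 0 < P m \<and>
      (\<forall>x1\<in>{\<alpha> m..\<beta> m}. \<forall>x2\<in>{\<alpha> m..\<beta> m}.
       \<forall>x3\<in>{\<alpha> (m + 1)..\<beta> (m + 1)}. \<forall>x4\<in>{\<alpha> (m + 1)..\<beta> (m + 1)}.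
         x1 \<le> x2 \<longrightarrow> x3 \<le> x4 \<longrightarrow>
         f m x1 x3 - f m x2 x4 \<le> P m * (x1 - x2) + K m * (x3 - x4))"
    and F_cont: "\<forall>k\<in>{1..p}. continuous_on UNIV (F k)"
    and F_bound: "\<exists>T :: nat \<Rightarrow> real. \<forall>k\<in>{1..p}. 0 < T k \<and>
      (\<forall>z1\<in>{\<alpha> (n k - 1)..\<beta> (n k - 1)}. \<forall>z2\<in>{\<alpha> (n k - 1)..\<beta> (n k - 1)}.
         z1 \<le> z2 \<longrightarrow> F k z1 - F k z2 \<le> T k * (z1 - z2))"
    and g_cont: "\<forall>k\<in>{1..p}. \<forall>m\<in>J_set n d k.
      continuous_on ({\<alpha> m..\<beta> m} \<times> {\<alpha> (n k)..\<beta> (n k)}) (\<lambda>(x, y). g m x y)"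
    and g_bound: "\<exists>M L :: nat \<Rightarrow> real. (\<forall>m\<in>J_union p n d. M m < 1 \<and> 0 < L m) \<and>
      (\<forall>k\<in>{1..p}. \<forall>m\<in>J_set n d k.
       \<forall>y1\<in>{\<alpha> m..\<beta> m}. \<forall>y2\<in>{\<alpha> m..\<beta> m}.
       \<forall>y3\<in>{\<alpha> (n k)..\<beta> (n k)}. \<forall>y4\<in>{\<alpha> (n k)..\<beta> (n k)}.
         y1 \<le> y2 \<longrightarrow> y3 \<le> y4 \<longrightarrow>
         g m y1 y3 - g m y2 y4 \<le> M m * (y1 - y2) + L m * (y3 - y4))"
  shows "\<exists>a b :: nat \<Rightarrow> nat \<Rightarrow> real.
      (\<forall>m\<in>grid p n. a 0 m = \<alpha> m \<and> b 0 m = \<beta> m) \<and>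
      (\<forall>m\<in>grid p n. incseq (\<lambda>j. a j m) \<and> decseq (\<lambda>j. b j m)) \<and>
      (\<forall>m\<in>grid p n. \<forall>j. \<alpha> m \<le> a j m \<and> a j m \<le> b j m \<and> b j m \<le> \<beta> m) \<and>
      (\<forall>j. lower_solution p n d f F g x0 (a j) \<and> upper_solution p n d f F g x0 (b j)) \<and>
      (\<forall>m\<in>grid p n. convergent (\<lambda>j. a j m) \<and> convergent (\<lambda>j. b j m)) \<and>
      minimal_solution p n d f F g x0 (sector p n \<alpha> \<beta>) (\<lambda>m. lim (\<lambda>j. a j m)) \<and>
      maximal_solution p n d f F g x0 (sector p n \<alpha> \<beta>) (\<lambda>m. lim (\<lambda>j. b j m)) \<and>
      (\<forall>u. unique_solution p n d f F g x0 (sector p n \<alpha> \<beta>) u \<longrightarrow>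
         (\<forall>m\<in>grid p n. lim (\<lambda>j. a j m) = u m \<and> u m = lim (\<lambda>j. b j m)))"
proof -
  obtain K P :: "nat \<Rightarrow> real" where f_slope: "\<And>m. m \<in> I_union p n d \<Longrightarrow> K m < 1 \<and> 0 < P m \<and>
      (\<forall>x1\<in>{\<alpha> m..\<beta> m}. \<forall>x2\<in>{\<alpha> m..\<beta> m}.
       \<forall>x3\<in>{\<alpha> (m + 1)..\<beta> (m + 1)}. \<forall>x4\<in>{\<alpha> (m + 1)..\<beta> (m + 1)}.
         x1 \<le> x2 \<longrightarrow> x3 \<le> x4 \<longrightarrow>
         f m x1 x3 - f m x2 x4 \<le> P m * (x1 - x2) + K m * (x3 - x4))"
    using f_bound by blast
  obtain C :: "nat \<Rightarrow> real" where F_slope: "\<And>k. k \<in> {1..p} \<Longrightarrow> 0 < C k \<and>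
      (\<forall>z1\<in>{\<alpha> (n k - 1)..\<beta> (n k - 1)}. \<forall>z2\<in>{\<alpha> (n k - 1)..\<beta> (n k - 1)}.
         z1 \<le> z2 \<longrightarrow> F k z1 - F k z2 \<le> C k * (z1 - z2))"
    using F_bound by blast
  obtain M L :: "nat \<Rightarrow> real" where M_less: "\<And>m. m \<in> J_union p n d \<Longrightarrow> M m < 1 \<and> 0 < L m"
    and g_slope: "\<And>k m. \<lbrakk>k \<in> {1..p}; m \<in> J_set n d k\<rbrakk> \<Longrightarrow>
       \<forall>y1\<in>{\<alpha> m..\<beta> m}. \<forall>y2\<in>{\<alpha> m..\<beta> m}.
       \<forall>y3\<in>{\<alpha> (n k)..\<beta> (n k)}. \<forall>y4\<in>{\<alpha> (n k)..\<beta> (n k)}.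
         y1 \<le> y2 \<longrightarrow> y3 \<le> y4 \<longrightarrow>
         g m y1 y3 - g m y2 y4 \<le> M m * (y1 - y2) + L m * (y3 - y4)"
    using g_bound by blast
  have J_in: "m \<in> J_union p n d" if "k \<in> {1..p}" "m \<in> J_set n d k" for k m
    using that by (auto simp: J_union_def)
  \<comment> \<open>At start and impulse nodes the right-hand side is constant in the node's own value: slope 0.\<close>
  let ?\<kappa> = "by_node p n d 0 (\<lambda>k. 0) (\<lambda>k. M) K"
  let ?\<pi> = "predecessor p n d"
  let ?h = "right_hand_side p n d f F g x0"
  note node = start_node[OF data] impulse_node[OF data] delay_node[OF data] step_node[OF data]
  note nodewise = ivp_rel_iff_nodewise[OF data]
  \<comment> \<open>The first argument contributes a nonpositive term, so only the slope in the second survives.\<close>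
  have drop: "c * (s1 - s2) \<le> 0" if "0 < c" "s1 \<le> s2" for c s1 s2 :: real
    using that by (simp add: mult_nonneg_nonpos)
  interpret slope_system "grid p n" ?\<pi> ?h ?\<kappa> \<alpha> \<beta>
  proof
    fix m assume m: "m \<in> grid p n"
    show "?\<pi> m \<in> grid p n" by (rule predecessor_in_grid[OF data m])
    show "?\<kappa> m < 1"
      using data m
    proof (cases rule: node_cases)
      case start
      then show ?thesis by (simp only: node zero_less_one)
    next
      case (impulse k)
      then show ?thesis by (simp only: node zero_less_one)
    next
      case (delay k)
      then show ?thesis using M_less[OF J_in[OF delay]] by (simp only: node)
    next
      case (step m')
      then show ?thesis using f_slope[OF step(1)] by (simp only: node)
    qed
    show "continuous_on ({\<alpha> (?\<pi> m)..\<beta> (?\<pi> m)} \<times> {\<alpha> m..\<beta> m}) (\<lambda>(s, y). ?h m s y)"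
      using data m
    proof (cases rule: node_cases)
      case start
      then show ?thesis by (simp only: node split_def continuous_on_const)
    next
      case (impulse k)
      have "continuous_on UNIV (F k)" using F_cont impulse by blast
      then have "continuous_on S (\<lambda>z. F k (fst z))" for S :: "(real \<times> real) set"
        by (rule continuous_on_compose2) (auto intro: continuous_intros)
      then show ?thesis using impulse by (simp only: node split_def)
    next
      case (delay k)
      then have "continuous_on ({\<alpha> m..\<beta> m} \<times> {\<alpha> (n k)..\<beta> (n k)}) (\<lambda>(x, y). g m x y)"
        using g_cont by blast
      then have "continuous_on ({\<alpha> (n k)..\<beta> (n k)} \<times> {\<alpha> m..\<beta> m})
          (\<lambda>z. (\<lambda>(x, y). g m x y) (prod.swap z))"
        by (rule continuous_on_compose2) (auto intro: continuous_on_swap)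
      then show ?thesis using delay by (simp only: node split_def fst_swap snd_swap)
    next
      case (step m')
      then show ?thesis using f_cont by (simp only: node)
    qed
    show "\<alpha> m \<le> ?h m (\<alpha> (?\<pi> m)) (\<alpha> m)"
      using lower m unfolding lower_solution_def nodewise by blast
    show "?h m (\<beta> (?\<pi> m)) (\<beta> m) \<le> \<beta> m"
      using upper m unfolding upper_solution_def nodewise by blast
    show "\<alpha> m \<le> \<beta> m" using ordered m by blast
  next
    fix m s1 s2 y1 y2
    assume m: "m \<in> grid p n"
      and s: "s1 \<in> {\<alpha> (?\<pi> m)..\<beta> (?\<pi> m)}" "s2 \<in> {\<alpha> (?\<pi> m)..\<beta> (?\<pi> m)}"
      and y: "y1 \<in> {\<alpha> m..\<beta> m}" "y2 \<in> {\<alpha> m..\<beta> m}" and le: "s1 \<le> s2" "y1 \<le> y2"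
    show "?h m s1 y1 - ?h m s2 y2 \<le> ?\<kappa> m * (y1 - y2)"
      using data m
    proof (cases rule: node_cases)
      case start
      then show ?thesis by (simp only: node mult_zero_left diff_self order_refl)
    next
      case (impulse k)
      have "F k s1 - F k s2 \<le> C k * (s1 - s2)"
        using F_slope[OF impulse(1)] s le impulse by (simp only: node)
      also have "\<dots> \<le> 0" using F_slope[OF impulse(1)] le by (intro drop) auto
      finally show ?thesis using impulse by (simp only: node mult_zero_left)
    next
      case (delay k)
      have "g m y1 s1 - g m y2 s2 \<le> M m * (y1 - y2) + L m * (s1 - s2)"
        using g_slope[OF delay] s y le delay by (simp only: node)
      moreover have "L m * (s1 - s2) \<le> 0"
        using M_less[OF J_in[OF delay]] le by (intro drop) auto
      ultimately have "g m y1 s1 - g m y2 s2 \<le> M m * (y1 - y2)" by linarith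
      then show ?thesis using delay by (simp only: node)
    next
      case (step m')
      have "f m' s1 y1 - f m' s2 y2 \<le> P m' * (s1 - s2) + K m' * (y1 - y2)"
        using f_slope[OF step(1)] s y le step by (simp only: node)
      moreover have "P m' * (s1 - s2) \<le> 0"
        using f_slope[OF step(1)] le by (intro drop) auto
      ultimately have "f m' s1 y1 - f m' s2 y2 \<le> K m' * (y1 - y2)" by linarith
      then show ?thesis using step by (simp only: node)
    qed
  qed
  \<comment> \<open>The operator contains \<open>n k - 1\<close> through \<open>?\<pi>\<close>; unfolding 1 would hide it from its rules.\<close>
  note One_nat_def [simp del]
  let ?A = "\<lambda>m. lim (\<lambda>j. lo j m)"
  let ?B = "\<lambda>m. lim (\<lambda>j. hi j m)"
  have sector: "sector p n \<alpha> \<beta> = order_interval (grid p n) \<alpha> \<beta>"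
    by (simp add: sector_def order_interval_def)
  have lower_iff: "lower_solution p n d f F g x0 u \<longleftrightarrow> (\<forall>m\<in>grid p n. u m \<le> relaxed u m)" for u
    unfolding lower_solution_def nodewise by (simp add: le_relaxed_iff)
  have upper_iff: "upper_solution p n d f F g x0 u \<longleftrightarrow> (\<forall>m\<in>grid p n. relaxed u m \<le> u m)" for u
    unfolding upper_solution_def nodewise by (simp add: relaxed_le_iff)
  have solution_iff: "u \<in> solutions_in p n d f F g x0 (sector p n \<alpha> \<beta>) \<longleftrightarrow>
      u \<in> order_interval (grid p n) \<alpha> \<beta> \<and> (\<forall>m\<in>grid p n. relaxed u m = u m)" for u
    unfolding solutions_in_def ivp_solution_def nodewise sector by (simp add: relaxed_eq_iff)
  have A_sol: "?A \<in> solutions_in p n d f F g x0 (sector p n \<alpha> \<beta>)"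
    using orbit_limit_fixed[OF iterates_in(1) lo_tendsto] by (simp add: solution_iff)
  have B_sol: "?B \<in> solutions_in p n d f F g x0 (sector p n \<alpha> \<beta>)"
    using orbit_limit_fixed[OF iterates_in(2) hi_tendsto] by (simp add: solution_iff)
  have minimal: "minimal_solution p n d f F g x0 (sector p n \<alpha> \<beta>) ?A"
    unfolding minimal_solution_def
  proof (intro conjI ballI A_sol)
    fix u m
    assume "u \<in> solutions_in p n d f F g x0 (sector p n \<alpha> \<beta>)" and m: "m \<in> grid p n"
    then have "lo j m \<le> u m" for j
      using fixed_point_between[of u m j] by (simp add: solution_iff)
    then show "?A m \<le> u m" by (intro LIMSEQ_le_const2[OF lo_tendsto[OF m]]) auto
  qed
  have maximal: "maximal_solution p n d f F g x0 (sector p n \<alpha> \<beta>) ?B"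
    unfolding maximal_solution_def
  proof (intro conjI ballI B_sol)
    fix u m
    assume "u \<in> solutions_in p n d f F g x0 (sector p n \<alpha> \<beta>)" and m: "m \<in> grid p n"
    then have "u m \<le> hi j m" for j
      using fixed_point_between[of u m j] by (simp add: solution_iff)
    then show "u m \<le> ?B m" by (intro LIMSEQ_le_const[OF hi_tendsto[OF m]]) auto
  qed
  have unique: "\<forall>u. unique_solution p n d f F g x0 (sector p n \<alpha> \<beta>) u \<longrightarrow>
      (\<forall>m\<in>grid p n. ?A m = u m \<and> u m = ?B m)"
    unfolding unique_solution_def using A_sol B_sol by fastforce
  have bounds: "\<forall>m\<in>grid p n. \<forall>j. \<alpha> m \<le> lo j m \<and> lo j m \<le> hi j m \<and> hi j m \<le> \<beta> m"
    using iterates_in lo_le_hi by (auto simp: order_interval_def)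
  have convergent: "\<forall>m\<in>grid p n. convergent (\<lambda>j. lo j m) \<and> convergent (\<lambda>j. hi j m)"
    using lo_tendsto hi_tendsto by (auto simp: convergent_def)
  have lower_upper: "\<forall>j. lower_solution p n d f F g x0 (lo j) \<and> upper_solution p n d f F g x0 (hi j)"
    unfolding lower_iff upper_iff by (intro allI conjI ballI lo_step hi_step)
  have monotone: "\<forall>m\<in>grid p n. incseq (\<lambda>j. lo j m) \<and> decseq (\<lambda>j. hi j m)"
    by (intro ballI conjI incseq_lo decseq_hi)
  have initial: "\<forall>m\<in>grid p n. lo 0 m = \<alpha> m \<and> hi 0 m = \<beta> m"
    by simp
  show ?thesis
    by (rule exI[of _ lo], rule exI[of _ hi],
      intro conjI initial monotone bounds lower_upper convergent minimal maximal unique)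
qed

end
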